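(* Let $n\ge 2$ be an integer, let $\mathcal{A}$ be a unital algebra over a commutative unital ring $\mathcal{R}$ with a nontrivial idempotent $e$, and put $f=1-e$. Suppose that $\mathcal{A}$ is $2$- and $(n-1)$-torsion free, that for each $x\in\mathcal{A}$: $exe\cdot e\mathcal{A}f=\{0\}=f\mathcal{A}e\cdot exe$ implies $exe=0$, and $e\mathcal{A}f\cdot fxf=\{0\}=fxf\cdot f\mathcal{A}e$ implies $fxf=0$, and that $e\mathcal{A}f\cdot f\mathcal{A}e=f\mathcal{A}e\cdot e\mathcal{A}f=\{0\}$. Let $\varphi$ be a Lie $n$-derivation on $\mathcal{A}$. Then $\varphi$ is of the form $\varphi=d+\delta+\gamma$, where $d$ is a derivation on $\mathcal{A}$, $\delta$ is a singular Jordan derivation and antiderivation on $\mathcal{A}$, and $\gamma$ is a linear mapping from $\mathcal{A}$ into $\mathcal{Z}(\mathcal{A})$ vanishing on all $(n-1)$-th commutators of $\mathcal{A}$, if and only if $f\varphi(e\mathcal{A}e)f\subseteq f\mathcal{Z}(\mathcal{A})f$ and $e\varphi(f\mathcal{A}f)e\subseteq e\mathcal{Z}(\mathcal{A})e$.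
   Context: Linear means $\mathcal{R}$-linear; $\mathcal{Z}(\mathcal{A})$ is the centre. Nontrivial idempotent: $e^2=e$, $e\ne 0,1$. For a positive integer $k$, $\mathcal{A}$ is $k$-torsion free if $kx=0$ implies $x=0$ for each $x\in\mathcal{A}$. $[x,y]=xy-yx$, $x\circ y=xy+yx$. Define $p_1(x_1)=x_1$ and $p_n(x_1,\dots,x_n)=[p_{n-1}(x_1,\dots,x_{n-1}),x_n]$ for $n\ge2$; for $n\ge 2$, $p_n(x_1,\dots,x_n)$ is called an $(n-1)$-th commutator. A linear map $\varphi:\mathcal{A}\to\mathcal{A}$ is a Lie $n$-derivation if $\varphi(p_n(x_1,\dots,x_n))=\sum_{i=1}^n p_n(x_1,\dots,x_{i-1},\varphi(x_i),x_{i+1},\dots,x_n)$ for all $x_1,\dots,x_n\in\mathcal{A}$. A linear map $\delta:\mathcal{A}\to\mathcal{A}$ is a derivation if $\delta(xy)=\delta(x)y+x\delta(y)$, an antiderivation if $\delta(xy)=\delta(y)x+y\delta(x)$, and a Jordan derivation if $\delta(x\circ y)=\delta(x)\circ y+x\circ\delta(y)$, for all $x,y$. A Jordan derivation $\delta$ is singular (with respect to $e$) if $\delta(e\mathcal{A}e)=\{0\}$, $\delta(f\mathcal{A}f)=\{0\}$, $\delta(e\mathcal{A}f)\subseteq f\mathcal{A}e$ and $\delta(f\mathcal{A}e)\subseteq e\mathcal{A}f$. *)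

theory Defs
  imports Complex_Main "HOL-Library.Set_Algebras"
begin

(* Both type classes include 0 \<noteq> 1. For the algebra this is implied by the existence of an
   idempotent e \<noteq> 0; for the scalars it then follows as well, since the action is unital. *)
locale unital_algebra = module scale
  for scale :: "'r::comm_ring_1 \<Rightarrow> 'a::ring_1 \<Rightarrow> 'a" +
  assumes scale_mult_left: "scale r x * y = scale r (x * y)"
    and scale_mult_right: "x * scale r y = scale r (x * y)"

abbreviation linear_map :: "('r::comm_ring_1 \<Rightarrow> 'a::ring_1 \<Rightarrow> 'a) \<Rightarrow> ('a \<Rightarrow> 'a) \<Rightarrow> bool" where
  "linear_map scale g \<equiv> module_hom scale scale g"

definition center :: "'a::ring_1 set" where
  "center = {z. \<forall>x. z * x = x * z}"

definition nontrivial_idempotent :: "'a::ring_1 \<Rightarrow> bool" where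
  "nontrivial_idempotent e \<longleftrightarrow> e ^ 2 = e \<and> e \<noteq> 0 \<and> e \<noteq> 1"

definition torsion_free :: "nat \<Rightarrow> 'a::ring_1 itself \<Rightarrow> bool" where
  "torsion_free k _ \<longleftrightarrow> (\<forall>x::'a. of_nat k * x = 0 \<longrightarrow> x = 0)"

definition commutator :: "'a::ring_1 \<Rightarrow> 'a \<Rightarrow> 'a" where
  "commutator x y = x * y - y * x"

definition jordan_product :: "'a::ring_1 \<Rightarrow> 'a \<Rightarrow> 'a" where
  "jordan_product x y = x * y + y * x"

(* lie_poly n x is p_n(x 1, ..., x n); the argument family is indexed from 1 and only its values
   at 1, ..., n matter. The value at n = 0 is a dummy. *)
fun lie_poly :: "nat \<Rightarrow> (nat \<Rightarrow> 'a::ring_1) \<Rightarrow> 'a" where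
  "lie_poly 0 x = 0"
| "lie_poly (Suc 0) x = x 1"
| "lie_poly (Suc (Suc n)) x = commutator (lie_poly (Suc n) x) (x (Suc (Suc n)))"

definition lie_n_derivation ::
    "('r::comm_ring_1 \<Rightarrow> 'a::ring_1 \<Rightarrow> 'a) \<Rightarrow> nat \<Rightarrow> ('a \<Rightarrow> 'a) \<Rightarrow> bool" where
  "lie_n_derivation scale n \<phi> \<longleftrightarrow> linear_map scale \<phi> \<and>
     (\<forall>x. \<phi> (lie_poly n x) = (\<Sum>i=1..n. lie_poly n (x(i := \<phi> (x i)))))"

definition derivation :: "('r::comm_ring_1 \<Rightarrow> 'a::ring_1 \<Rightarrow> 'a) \<Rightarrow> ('a \<Rightarrow> 'a) \<Rightarrow> bool" where
  "derivation scale d \<longleftrightarrow> linear_map scale d \<and> (\<forall>x y. d (x * y) = d x * y + x * d y)"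

definition antiderivation :: "('r::comm_ring_1 \<Rightarrow> 'a::ring_1 \<Rightarrow> 'a) \<Rightarrow> ('a \<Rightarrow> 'a) \<Rightarrow> bool" where
  "antiderivation scale d \<longleftrightarrow> linear_map scale d \<and> (\<forall>x y. d (x * y) = d y * x + y * d x)"

definition jordan_derivation :: "('r::comm_ring_1 \<Rightarrow> 'a::ring_1 \<Rightarrow> 'a) \<Rightarrow> ('a \<Rightarrow> 'a) \<Rightarrow> bool" where
  "jordan_derivation scale d \<longleftrightarrow> linear_map scale d \<and>
     (\<forall>x y. d (jordan_product x y) = jordan_product (d x) y + jordan_product x (d y))"

definition corner :: "'a::ring_1 \<Rightarrow> 'a set \<Rightarrow> 'a \<Rightarrow> 'a set" where
  "corner a S b = {a * s * b |s. s \<in> S}"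

definition singular_jordan_derivation ::
    "('r::comm_ring_1 \<Rightarrow> 'a::ring_1 \<Rightarrow> 'a) \<Rightarrow> 'a \<Rightarrow> ('a \<Rightarrow> 'a) \<Rightarrow> bool" where
  "singular_jordan_derivation scale e \<delta> \<longleftrightarrow> jordan_derivation scale \<delta> \<and>
     (let f = 1 - e in
        \<delta> ` corner e UNIV e = {0} \<and> \<delta> ` corner f UNIV f = {0} \<and>
        \<delta> ` corner e UNIV f \<subseteq> corner f UNIV e \<and> \<delta> ` corner f UNIV e \<subseteq> corner e UNIV f)"

end

theory Submission imports Defs
begin

text \<open>
  Write \<open>M = eAf\<close> and \<open>N = fAe\<close>. Since \<open>MN = NM = 0\<close>, the product of any two elements of
  \<open>M + N\<close> vanishes, and outside the corners products amount to the four actions of the corners \<open>eAe\<close> and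
  \<open>fAf\<close> on \<open>M\<close> and \<open>N\<close>. The faithfulness hypothesis says that a corner element is determined by
  these actions; hence \<open>a + b\<close> with \<open>a\<close> in \<open>eAe\<close>, \<open>b\<close> in \<open>fAf\<close> is central as soon as \<open>am = mb\<close>
  and \<open>ta = bt\<close> for \<open>m\<close> in \<open>M\<close>, \<open>t\<close> in \<open>N\<close> (lemma \<open>centralI\<close>), and a central element is
  determined by either of its corners (\<open>center_eqI\<close>).

  If \<open>\<phi> = d + \<delta> + \<gamma>\<close>, then the \<open>f\<close>-corner of \<open>\<phi>(eae)\<close> is that of \<open>\<gamma>(eae)\<close>: a derivation maps
  \<open>eAe\<close> to elements with zero \<open>f\<close>-corner and \<open>\<delta>\<close> kills \<open>eAe\<close>. This is the easy direction.

  For the converse, iterated brackets with \<open>f\<close> isolate the off-diagonal part: \<open>[y, f]\<close> is \<open>y\<close> on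
  \<open>M\<close>, \<open>-y\<close> on \<open>N\<close> and \<open>0\<close> on the corners. Applying \<open>\<phi>\<close> to \<open>p_n(m, f, \<dots>, f)\<close>, the \<open>n - 1\<close>
  terms in which \<open>\<phi>\<close> hits an \<open>f\<close> all equal \<open>[m, \<phi>(f)]\<close>, so torsion freeness makes \<open>\<phi>(f)\<close>
  commute with \<open>M\<close>, and similarly with \<open>N\<close>: its diagonal part is central
  (\<open>phi_f_diagonal_part_central\<close>). The off-diagonal part is removed by subtracting an inner
  derivation. Once \<open>\<phi>(f)\<close> is central, \<open>\<phi>\<close> satisfies, up to powers of \<open>[-, f]\<close>, the Leibniz rule for
  a single bracket (\<open>lie_product_identity\<close>). It follows that \<open>\<phi>\<close> preserves the diagonal and the
  off-diagonal part. Its part from \<open>M\<close> to \<open>N\<close> and from \<open>N\<close> to \<open>M\<close> satisfies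
  \<open>\<delta>(am) = \<delta>(m) a\<close> and the like, so it is the antiderivation \<open>\<delta>\<close>. The unwanted components
  \<open>f \<phi>(eae) f\<close> and \<open>e \<phi>(fbf) e\<close> are, by the hypothesis on the corners, those of unique central
  elements, which define \<open>\<gamma>\<close> (\<open>central_lift\<close>). What remains obeys the product rule on the four
  module actions, and by faithfulness also inside the corners (\<open>derivation_corner\<close>), so it is a
  derivation.

  Finally \<open>\<gamma>\<close> vanishes on commutators since passing to a corner is multiplicative: the
  \<open>f\<close>-corner of each term of \<open>\<phi>(p_n(a_1, \<dots>, a_n))\<close> with all \<open>a_i\<close> in \<open>eAe\<close> is a commutator of
  \<open>f\<close>-corners, at least one of which is \<open>0\<close> (\<open>central_lift_vanishes\<close>).
\<close>

section \<open>Iterated commutators\<close>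

lemma commutator_simps [simp]:
  "commutator 0 x = 0" "commutator x 0 = 0" "commutator x 1 = 0" "commutator 1 x = 0"
  by (simp_all add: commutator_def)

lemma of_nat_inner: "p * (of_nat m * u) * q = of_nat m * (p * u * q)" for p u q :: "'a::ring_1"
  by (induction m) (simp_all add: algebra_simps)

lemma lie_poly_cong:
  assumes "\<And>i. 1 \<le> i \<Longrightarrow> i \<le> n \<Longrightarrow> x i = y i"
  shows "lie_poly n x = lie_poly n y"
  using assms by (induction n x rule: lie_poly.induct) auto

lemma lie_poly_diff:
  assumes "1 \<le> i" "i \<le> n"
  shows "lie_poly n (x(i := u - v)) = lie_poly n (x(i := u)) - lie_poly n (x(i := v))"
  using assms
proof (induction n x rule: lie_poly.induct)
  case (3 n x)
  show ?case
  proof (cases "i = Suc (Suc n)")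
    case True
    then have "lie_poly (Suc n) (x(i := w)) = lie_poly (Suc n) x" for w
      by (intro lie_poly_cong) auto
    with True show ?thesis by (simp add: commutator_def del: fun_upd_apply) (simp add: algebra_simps)
  next
    case False
    with 3 have "lie_poly (Suc n) (x(i := u - v)) = lie_poly (Suc n) (x(i := u)) - lie_poly (Suc n) (x(i := v))"
      by (simp del: fun_upd_apply)
    moreover have "(x(i := w)) (Suc (Suc n)) = x (Suc (Suc n))" for w
      using False by simp
    ultimately show ?thesis
      by (simp add: commutator_def del: fun_upd_apply) (simp add: algebra_simps)
  qed
qed auto

lemma lie_poly_zero_entry:
  assumes "1 \<le> i" "i \<le> n" "x i = 0"
  shows "lie_poly n x = 0"
  using assms
proof (induction n x rule: lie_poly.induct)
  case (3 n x)
  then show ?case by (cases "i = Suc (Suc n)") auto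
qed auto

lemma leibniz_lie_poly:
  assumes add: "\<And>x y. d (x + y) = d x + d y"
    and mult: "\<And>x y. d (x * y) = d x * y + x * d y"
    and "n \<ge> 1"
  shows "d (lie_poly n x) = (\<Sum>i=1..n. lie_poly n (x(i := d (x i))))"
  using assms(3)
proof (induction n x rule: lie_poly.induct)
  case (3 n x)
  have zero: "d 0 = 0" using add[of 0 0] by simp
  have diff: "d (u - v) = d u - d v" for u v
    using add[of "u - v" v] by simp
  have head: "lie_poly (Suc (Suc n)) (x(i := d (x i)))
      = commutator (lie_poly (Suc n) (x(i := d (x i)))) (x (Suc (Suc n)))"
    if "i \<in> {1..Suc n}" for i
    using that by auto
  have last: "lie_poly (Suc n) (x(Suc (Suc n) := w)) = lie_poly (Suc n) x" for w
    by (intro lie_poly_cong) auto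
  have csum: "commutator (sum g S) y = (\<Sum>i\<in>S. commutator (g i) y)" for g :: "nat \<Rightarrow> 'a" and S y
    by (simp add: commutator_def sum_distrib_left sum_distrib_right sum_subtractf)
  have "(\<Sum>i=1..Suc (Suc n). lie_poly (Suc (Suc n)) (x(i := d (x i))))
      = (\<Sum>i=1..Suc n. commutator (lie_poly (Suc n) (x(i := d (x i)))) (x (Suc (Suc n))))
        + commutator (lie_poly (Suc n) x) (d (x (Suc (Suc n))))"
    using last by (simp add: sum.cl_ivl_Suc head del: lie_poly.simps(2) fun_upd_apply) simp
  also have "\<dots> = commutator (d (lie_poly (Suc n) x)) (x (Suc (Suc n)))
        + commutator (lie_poly (Suc n) x) (d (x (Suc (Suc n))))"
    using 3 by (simp add: csum del: sum.cl_ivl_Suc fun_upd_apply)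
  also have "\<dots> = d (lie_poly (Suc (Suc n)) x)"
    by (simp add: commutator_def diff mult)
  finally show ?case by (rule sym)
qed auto

lemma lie_poly_ad:
  assumes "1 \<le> i" "i \<le> n" "\<And>j. i < j \<Longrightarrow> j \<le> n \<Longrightarrow> x j = g"
  shows "lie_poly n x = ((\<lambda>y. commutator y g) ^^ (n - i)) (lie_poly i x)"
  using assms
proof (induction n x rule: lie_poly.induct)
  case (3 n x)
  then show ?case by (cases "i = Suc (Suc n)") (auto simp: Suc_diff_le)
qed auto

section \<open>Peirce decompositions with null off-diagonal products\<close>

text \<open>
  The assumptions are symmetric under exchanging \<open>e\<close> and \<open>f\<close>, so each fact about \<open>eAe\<close> and
  \<open>M = eAf\<close> gives one about \<open>fAf\<close> and \<open>N = fAe\<close> by interpreting the locale at the swapped pair.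
\<close>
locale null_peirce_algebra = unital_algebra scale
  for scale :: "'r::comm_ring_1 \<Rightarrow> 'a::ring_1 \<Rightarrow> 'a" +
  fixes e f :: 'a
  assumes sum_one: "e + f = 1"
    and ee: "e * e = e"
    and efe: "e * x * f * y * e = 0"
    and fef: "f * x * e * y * f = 0"
    and faithful_e: "(\<And>y. e * x * e * y * f = 0) \<Longrightarrow> (\<And>y. f * y * e * x * e = 0) \<Longrightarrow> e * x * e = 0"
    and faithful_f: "(\<And>y. f * x * f * y * e = 0) \<Longrightarrow> (\<And>y. e * y * f * x * f = 0) \<Longrightarrow> f * x * f = 0"
begin

lemma f_eq: "f = 1 - e"
  using sum_one by (simp add: eq_diff_eq add.commute)

lemma ff: "f * f = f" and ef: "e * f = 0" and fe: "f * e = 0"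
  by (simp_all add: f_eq algebra_simps ee)

lemma swap: "null_peirce_algebra scale f e"
  by unfold_locales
    (use sum_one ff efe fef faithful_e faithful_f in \<open>auto simp: add.commute\<close>)

text \<open>
  Rewrite rules for right-associated words in \<open>e\<close>, \<open>f\<close> and arbitrary elements. With
  \<open>mult.assoc\<close> and distributivity they settle the identities between Peirce components below.
\<close>
lemma words:
  "e * e = e" "f * f = f" "e * f = 0" "f * e = 0"
  "e * (e * x) = e * x" "f * (f * x) = f * x" "e * (f * x) = 0" "f * (e * x) = 0"
  "e * (x * (f * (y * e))) = 0" "e * (x * (f * (y * (e * z)))) = 0"
  "f * (x * (e * (y * f))) = 0" "f * (x * (e * (y * (f * z)))) = 0"
proof -
  show "e * (x * (f * (y * e))) = 0" "f * (x * (e * (y * f))) = 0"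
    using efe[of x y] fef[of x y] by (simp_all add: mult.assoc)
  then have "e * (x * (f * (y * e))) * z = 0" "f * (x * (e * (y * f))) * z = 0"
    by simp_all
  then show "e * (x * (f * (y * (e * z)))) = 0" "f * (x * (e * (y * (f * z)))) = 0"
    by (simp_all add: mult.assoc)
qed (simp_all add: ee ff ef fe mult.assoc[symmetric])

lemmas word_simps = mult.assoc words distrib_left distrib_right left_diff_distrib right_diff_distrib

lemma right_split: "x = x * e + x * f" and left_split: "x = e * x + f * x"
  by (simp_all add: sum_one flip: distrib_left distrib_right)

lemma peirce: "x = e * x * e + e * x * f + f * x * e + f * x * f"
proof -
  have "x = (e + f) * x * (e + f)" by (simp add: sum_one)
  then show ?thesis by (simp add: algebra_simps)
qed

lemma peirce_eqI:
  assumes "e * x * e = e * y * e" "e * x * f = e * y * f" "f * x * e = f * y * e" "f * x * f = f * y * f"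
  shows "x = y"
  by (subst peirce, subst (5) peirce) (simp add: assms)

text \<open>Since \<open>MN = NM = 0\<close>, multiplying an element of \<open>M\<close> on either side gives an element of \<open>M\<close>.\<close>
lemma M_right: "e * x * f * y = e * x * f * y * f"
  by (subst right_split) (simp add: word_simps)

lemma M_left: "y * e * x * f = e * y * e * x * f"
proof -
  have "y * e * x * f = (e + f) * y * e * x * f" by (simp add: sum_one)
  then show ?thesis by (simp add: word_simps)
qed

text \<open>
  The commutator of \<open>eze\<close> with a corner element kills \<open>M\<close> and \<open>N\<close>: acting by \<open>eze\<close> on \<open>M\<close> from the
  left is acting by \<open>fzf\<close> from the right, and the left and right actions on \<open>M\<close> commute. Faithfulness
  concludes.
\<close>
lemma corner_commute:
  assumes M: "\<And>x. e * z * e * x * f = e * x * f * z * f"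
    and N: "\<And>x. f * x * e * z * e = f * z * f * x * e"
  shows "e * z * e * x * e = e * x * e * z * e"
proof -
  let ?X = "z * e * x - x * e * z"
  have "e * ?X * e * y * f = 0" for y
    using M[of "x * e * y"] M[of y] by (simp add: word_simps)
  moreover have "f * y * e * ?X * e = 0" for y
  proof -
    have "f * y * e * z * e * x * e = f * z * f * y * e * x * e"
      by (simp add: N)
    moreover have "f * y * e * x * e * z * e = f * z * f * y * e * x * e"
      using N[of "y * e * x"] by (simp add: mult.assoc)
    ultimately show ?thesis by (simp add: word_simps)
  qed
  ultimately have "e * ?X * e = 0" by (rule faithful_e)
  then show ?thesis by (simp add: word_simps)
qed

lemma centralI:
  assumes diag: "e * z * f = 0" "f * z * e = 0"
    and M: "\<And>x. e * z * e * x * f = e * x * f * z * f"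
    and N: "\<And>x. f * x * e * z * e = f * z * f * x * e"
  shows "z \<in> center"
proof -
  interpret swap: null_peirce_algebra scale f e by (rule swap)
  have z: "e * z = e * z * e" "z * e = e * z * e" "f * z = f * z * f" "z * f = f * z * f"
    by (rule trans[OF right_split] trans[OF left_split], simp add: diag flip: mult.assoc)+
  have zl: "p * z * x * q = p * z * p * x * q" and zr: "p * x * z * q = p * x * q * z * q"
    if "p \<in> {e, f}" "q \<in> {e, f}" for p q x
  proof -
    have pz: "p * z = p * z * p" and zq: "z * q = q * z * q"
      using that z by blast+
    show "p * z * x * q = p * z * p * x * q"
      using arg_cong[OF pz, of "\<lambda>u. u * x * q"] .
    show "p * x * z * q = p * x * q * z * q"
      using arg_cong[OF zq, of "\<lambda>u. p * x * u"] by (simp only: mult.assoc)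
  qed
  have "z * x = x * z" for x
  proof (rule peirce_eqI)
    show "e * (z * x) * e = e * (x * z) * e"
      using zl[of e e x] zr[of e e x] corner_commute[OF M N] by (simp add: mult.assoc)
    show "e * (z * x) * f = e * (x * z) * f"
      using zl[of e f x] zr[of e f x] M by (simp add: mult.assoc)
    show "f * (z * x) * e = f * (x * z) * e"
      using zl[of f e x] zr[of f e x] N by (simp add: mult.assoc)
    show "f * (z * x) * f = f * (x * z) * f"
      using zl[of f f x] zr[of f f x] swap.corner_commute[OF N[symmetric] M[symmetric]]
      by (simp add: mult.assoc)
  qed
  then show ?thesis by (simp add: center_def)
qed

lemma center_commute: "z \<in> center \<Longrightarrow> z * x = x * z"
  by (simp add: center_def)

lemma center_diag:
  assumes "z \<in> center"
  shows "e * z * f = 0" "f * z * e = 0"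
  using center_commute[OF assms, of e] center_commute[OF assms, of f]
  by (simp_all add: mult.assoc words)

lemma center_intertwines:
  assumes "z \<in> center"
  shows "e * z * e * y * f = e * y * f * z * f"
proof -
  have "e * z * e * y * f = e * (z * (e * y * f))"
    by (simp add: mult.assoc)
  also have "\<dots> = e * y * f * z"
    by (simp add: center_commute[OF assms] mult.assoc words)
  also have "\<dots> = e * y * f * z * f" by (rule M_right)
  finally show ?thesis .
qed

text \<open>
  If the \<open>f\<close>-corner of a central element is zero, its \<open>e\<close>-corner acts as zero on \<open>M\<close> and \<open>N\<close>, where
  the two corners act alike.
\<close>
lemma center_zeroI:
  assumes z: "z \<in> center" and fzf: "f * z * f = 0"
  shows "z = 0"
proof -
  have "e * z * e = 0"
  proof (rule faithful_e)
    fix y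
    have "e * z * e * y * f = e * y * (f * z * f)"
      using center_intertwines[OF z] by (simp add: mult.assoc)
    then show "e * z * e * y * f = 0" by (simp add: fzf)
    have "z * f = f * z * f"
      using center_commute[OF z, of f] by (metis ff mult.assoc)
    moreover have "f * y * e * z * e = (z * f) * y * e"
      using center_commute[OF z, of "f * y * e"] by (metis ee mult.assoc)
    ultimately show "f * y * e * z * e = 0" by (simp add: fzf)
  qed
  then show ?thesis
    using center_diag[OF z] fzf peirce[of z] by simp
qed

lemma center_linear:
  shows "z \<in> center \<Longrightarrow> w \<in> center \<Longrightarrow> z + w \<in> center"
    and "z \<in> center \<Longrightarrow> w \<in> center \<Longrightarrow> z - w \<in> center"
    and "z \<in> center \<Longrightarrow> scale r z \<in> center"
  by (simp_all add: center_def algebra_simps scale_mult_left scale_mult_right)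

lemma center_eqI:
  assumes "z \<in> center" "w \<in> center" "f * z * f = f * w * f"
  shows "z = w"
  using center_zeroI[of "z - w"] center_linear(2)[OF assms(1,2)] assms(3) by (simp add: algebra_simps)

text \<open>
  The elements \<open>p x q y r\<close>, with \<open>p, q, r\<close> running over \<open>{e, f}\<close>, add up to \<open>xy\<close>; the product rule is
  the sum of the eight corresponding instances.
\<close>
lemma derivation_from_components:
  assumes add: "\<And>x y. d (x + y) = d x + d y"
    and mult: "\<And>p q r x y. p \<in> {e, f} \<Longrightarrow> q \<in> {e, f} \<Longrightarrow> r \<in> {e, f} \<Longrightarrow>
       d (p * x * q * y * r) = d (p * x * q) * y * r + p * x * d (q * y * r)"
  shows "d (x * y) = d x * y + x * d y"
proof -
  have split: "d x = d (e * x * e) + d (e * x * f) + d (f * x * e) + d (f * x * f)" for x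
    by (subst peirce) (simp only: add)
  have "p * (x * y) * r = p * x * e * y * r + p * x * f * y * r" for p r
    by (subst left_split[of y]) (simp add: algebra_simps)
  then have xy: "d (x * y) = d (e * x * e * y * e) + d (e * x * f * y * e)
      + (d (e * x * e * y * f) + d (e * x * f * y * f)) + (d (f * x * e * y * e) + d (f * x * f * y * e))
      + (d (f * x * e * y * f) + d (f * x * f * y * f))"
    by (subst split) (simp only: add)
  have l: "d (p * x * q) * y = d (p * x * q) * y * e + d (p * x * q) * y * f" for p q
    by (rule right_split)
  have r: "x * d (q * y * r) = e * x * d (q * y * r) + f * x * d (q * y * r)" for q r
    using left_split[of "x * d (q * y * r)"] by (simp only: mult.assoc)
  have "d x * y = d (e * x * e) * y * e + d (e * x * e) * y * f + (d (e * x * f) * y * e + d (e * x * f) * y * f)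
      + (d (f * x * e) * y * e + d (f * x * e) * y * f) + (d (f * x * f) * y * e + d (f * x * f) * y * f)"
    by (simp only: split[of x] distrib_right l[symmetric])
  moreover have "x * d y = e * x * d (e * y * e) + f * x * d (e * y * e) + (e * x * d (e * y * f) + f * x * d (e * y * f))
      + (e * x * d (f * y * e) + f * x * d (f * y * e)) + (e * x * d (f * y * f) + f * x * d (f * y * f))"
    by (simp only: split[of y] distrib_left r[symmetric])
  ultimately show ?thesis by (simp add: xy mult)
qed

text \<open>
  Expanding \<open>d(xyw)\<close> for \<open>x, y\<close> in \<open>eAe\<close> and \<open>w\<close> in \<open>M\<close> in two ways by the rule for \<open>eAe\<close> acting on
  \<open>M\<close> shows that the defect \<open>d(xy) - d(x)y - xd(y)\<close> annihilates \<open>M\<close>; likewise it annihilates \<open>N\<close>.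
\<close>
lemma derivation_corner:
  assumes comp: "\<And>p q x. p \<in> {e, f} \<Longrightarrow> q \<in> {e, f} \<Longrightarrow> d (p * x * q) = p * d (p * x * q) * q"
    and M: "\<And>x y. d (e * x * e * y * f) = d (e * x * e) * y * f + e * x * d (e * y * f)"
    and N: "\<And>x y. d (f * x * e * y * e) = d (f * x * e) * y * e + f * x * d (e * y * e)"
  shows "d (e * x * e * y * e) = d (e * x * e) * y * e + e * x * d (e * y * e)"
proof -
  define X where "X = d (e * x * e * y * e) - d (e * x * e) * y * e - e * x * d (e * y * e)"
  have c: "e * d (e * u * e) = d (e * u * e)" "d (e * u * e) * e = d (e * u * e)" for u
    using comp[of e e u] by (metis ee mult.assoc insertI1)+
  have cc: "d (e * (u * e)) * (e * v) = d (e * (u * e)) * v" for u v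
    using c(2)[of u] by (metis mult.assoc)
  have X: "e * X * e = X"
    using c(1)[of "x * e * y"] c(2)[of "x * e * y"] c(1)[of x] c(2)[of y]
    by (simp add: X_def algebra_simps words) (simp add: mult.assoc[symmetric])
  have "X * w * f = 0" for w
  proof -
    have "d (e * (x * e * y) * e * w * f) = d (e * x * e) * (e * y * e * w) * f + e * x * d (e * (e * y * e * w) * f)"
      using M[of x "e * y * e * w"] by (simp add: mult.assoc words)
    moreover have "d (e * (e * y * e * w) * f) = d (e * y * e) * w * f + e * y * d (e * w * f)"
      using M[of y w] by (simp add: mult.assoc words)
    ultimately show ?thesis
      using M[of "x * e * y" w] by (simp add: X_def algebra_simps words cc)
  qed
  then have 1: "e * X * e * w * f = 0" for w by (simp add: X)
  have "f * w * X = 0" for w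
    using N[of w "x * e * y"] N[of "w * e * x" y] N[of w x]
    by (simp add: X_def algebra_simps)
  then have 2: "f * w * e * X * e = 0" for w
    using X by (metis mult.assoc)
  from 1 2 have "e * X * e = 0" by (rule faithful_e)
  then have "X = 0" by (simp add: X)
  then show ?thesis by (simp add: X_def algebra_simps)
qed

text \<open>
  The \<open>j\<close>-fold iterate of \<open>y \<mapsto> [y, f]\<close>: the identity on \<open>M\<close>, multiplication by \<open>(-1)^j\<close> on
  \<open>N\<close>, and zero on the corners when \<open>j > 0\<close>.
\<close>
abbreviation ad :: "nat \<Rightarrow> 'a \<Rightarrow> 'a" where
  "ad j y \<equiv> ((\<lambda>y. commutator y f) ^^ j) y"

lemma ad_Suc: "ad (Suc j) y = e * y * f - (- 1) ^ j * (f * y * e)"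
proof (induction j)
  case 0
  have "commutator y f = (e + f) * y * f - f * y * (e + f)"
    by (simp add: sum_one commutator_def)
  then show ?case by (simp add: algebra_simps)
next
  case (Suc j)
  have "ad (Suc (Suc j)) y = commutator (ad (Suc j) y) f" by simp
  also have "\<dots> = e * y * f - (- 1) ^ Suc j * (f * y * e)"
    by (cases "even j") (simp_all only: Suc, simp_all add: commutator_def word_simps)
  finally show ?case .
qed

lemma ad_zero: "ad j 0 = 0"
  by (induction j) simp_all

lemma ad_M: "ad j (e * y * f) = e * y * f"
  by (cases j) (simp_all add: ad_Suc word_simps del: funpow.simps(2))

lemma ad_N: "ad j (f * y * e) = (- 1) ^ j * (f * y * e)"
  by (cases j) (simp_all add: ad_Suc word_simps del: funpow.simps(2))

lemma ad_shift: "ad j (commutator y f) = ad (Suc j) y"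
  by (simp only: funpow_Suc_right o_apply)

lemma ad_proj:
  shows "e * ad j y * f = e * y * f" "f * ad j y * e = (- 1) ^ j * (f * y * e)"
proof -
  have "e * ad j y * f = e * y * f \<and> f * ad j y * e = (- 1) ^ j * (f * y * e)"
  proof (cases j)
    case (Suc i)
    then show ?thesis
      by (cases "even i") (simp_all add: ad_Suc word_simps del: funpow.simps(2))
  qed simp
  then show "e * ad j y * f = e * y * f" "f * ad j y * e = (- 1) ^ j * (f * y * e)"
    by auto
qed

end

section \<open>Lie derivations\<close>

text \<open>The order \<open>n \<ge> 2\<close> is written \<open>k + 2\<close>, \<open>k\<close> being the number of brackets after the first.\<close>
locale lie_derivation_null_peirce = null_peirce_algebra scale e f
  for scale :: "'r::comm_ring_1 \<Rightarrow> 'a::ring_1 \<Rightarrow> 'a" and e f :: 'a +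
  fixes \<phi> :: "'a \<Rightarrow> 'a" and k :: nat
  assumes lie: "lie_n_derivation scale (Suc (Suc k)) \<phi>"
begin

lemma linear: "linear_map scale \<phi>"
  using lie by (simp add: lie_n_derivation_def)

lemmas phi_simps [simp] = module_hom.zero[OF linear] module_hom.neg[OF linear]
lemmas phi_add = module_hom.add[OF linear]

text \<open>
  The defining identity at \<open>(u, v, f, \<dots>, f)\<close>. The sum collects the terms in which \<open>\<phi>\<close> is
  applied to one of the trailing \<open>f\<close>s; there are \<open>j\<close> of them before it.
\<close>
lemma lie_identity:
  "\<phi> (ad k (commutator u v)) = ad k (commutator (\<phi> u) v) + ad k (commutator u (\<phi> v))
     + (\<Sum>j<k. ad (k - Suc j) (commutator (ad j (commutator u v)) (\<phi> f)))"
proof -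
  define X :: "nat \<Rightarrow> 'a" where "X = (\<lambda>_. f)(1 := u, 2 := v)"
  have ev: "lie_poly (Suc (Suc k)) Y = ad k (commutator (Y 1) (Y 2))"
    if "\<And>j. j > 2 \<Longrightarrow> Y j = f" for Y :: "nat \<Rightarrow> 'a"
    using lie_poly_ad[of 2 "Suc (Suc k)" Y f] that by (simp add: numeral_2_eq_2)
  have tail: "lie_poly (Suc (Suc k)) (X(j + 3 := \<phi> (X (j + 3))))
      = ad (k - Suc j) (commutator (ad j (commutator u v)) (\<phi> f))" if "j < k" for j
  proof -
    let ?Y = "X(j + 3 := \<phi> f)"
    have "lie_poly (j + 2) ?Y = ad j (lie_poly 2 ?Y)"
      using lie_poly_ad[of 2 "j + 2" ?Y f] by (simp add: X_def)
    moreover have "lie_poly 2 ?Y = commutator u v"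
      by (simp add: numeral_2_eq_2 X_def)
    moreover have "lie_poly (j + 3) ?Y = commutator (lie_poly (j + 2) ?Y) (\<phi> f)"
      by (simp add: numeral_3_eq_3)
    ultimately have "lie_poly (j + 3) ?Y = commutator (ad j (commutator u v)) (\<phi> f)"
      by simp
    moreover have "lie_poly (Suc (Suc k)) ?Y = ad (k - Suc j) (lie_poly (j + 3) ?Y)"
      using lie_poly_ad[of "j + 3" "Suc (Suc k)" ?Y f] that by (simp add: X_def numeral_3_eq_3)
    moreover have "X (j + 3) = f" by (simp add: X_def)
    ultimately show ?thesis by (simp del: fun_upd_apply)
  qed
  have sums: "(\<Sum>i=1..Suc (Suc m). g i) = g 1 + g 2 + (\<Sum>j<m. g (j + 3))" for g :: "nat \<Rightarrow> 'a" and m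
    by (induction m) (simp_all add: numeral_2_eq_2 numeral_3_eq_3 add.assoc)
  have "\<phi> (lie_poly (Suc (Suc k)) X) = (\<Sum>i=1..Suc (Suc k). lie_poly (Suc (Suc k)) (X(i := \<phi> (X i))))"
    using lie unfolding lie_n_derivation_def by blast
  also have "\<dots> = lie_poly (Suc (Suc k)) (X(1 := \<phi> (X 1))) + lie_poly (Suc (Suc k)) (X(2 := \<phi> (X 2)))
     + (\<Sum>j<k. ad (k - Suc j) (commutator (ad j (commutator u v)) (\<phi> f)))"
    unfolding sums by (intro arg_cong2[where f = plus] refl sum.cong tail) simp
  also have "lie_poly (Suc (Suc k)) X = ad k (commutator u v)"
    by (subst ev) (auto simp: X_def)
  also have "lie_poly (Suc (Suc k)) (X(1 := \<phi> (X 1))) = ad k (commutator (\<phi> u) v)"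
    by (subst ev) (auto simp: X_def)
  also have "lie_poly (Suc (Suc k)) (X(2 := \<phi> (X 2))) = ad k (commutator u (\<phi> v))"
    by (subst ev) (auto simp: X_def)
  finally show ?thesis .
qed

text \<open>
  At \<open>(y, f, \<dots>, f)\<close> with \<open>y\<close> in \<open>M\<close>, each of the \<open>k + 1\<close> terms with \<open>\<phi>\<close> on an \<open>f\<close> equals
  \<open>[y, \<phi>(f)]\<close>, as brackets with \<open>f\<close> fix \<open>M\<close>; the remaining term has the same \<open>M\<close>-component
  as the left-hand side, which leaves \<open>(k + 1) [y, \<phi>(f)] = 0\<close>.
\<close>
lemma phi_f_commutes_M:
  assumes torsion: "\<And>x::'a. of_nat (Suc k) * x = 0 \<Longrightarrow> x = 0"
  shows "commutator (e * y * f) (\<phi> f) = 0"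
proof -
  let ?y = "e * y * f"
  let ?w = "commutator ?y (\<phi> f)"
  have yf: "commutator ?y f = ?y"
    by (simp add: commutator_def word_simps)
  have w: "?w = e * ?w * f"
    using M_right[of y "\<phi> f"] M_left[of "\<phi> f" y] by (simp add: commutator_def word_simps)
  have adw: "ad j ?w = ?w" for j
    using ad_M[of j ?w] unfolding w[symmetric] .
  have "\<phi> ?y = ad (Suc k) (\<phi> ?y) + of_nat (Suc k) * ?w"
    using lie_identity[of ?y f] unfolding yf ad_M adw
    by (simp add: ad_shift distrib_right add.assoc del: funpow.simps(2))
  then have "e * \<phi> ?y * f = e * (ad (Suc k) (\<phi> ?y) + of_nat (Suc k) * ?w) * f"
    by (rule arg_cong)
  also have "\<dots> = e * \<phi> ?y * f + of_nat (Suc k) * ?w"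
    by (simp only: distrib_left distrib_right ad_proj of_nat_inner w[symmetric])
  finally have "of_nat (Suc k) * ?w = 0" by simp
  then show ?thesis by (rule torsion)
qed

text \<open>
  The same comparison on \<open>N\<close>, where a bracket with \<open>f\<close> changes the sign. It is not the mirror image
  of the previous lemma under exchanging \<open>e\<close> and \<open>f\<close>, which would speak of \<open>\<phi>(e)\<close>.
\<close>
lemma phi_f_commutes_N:
  assumes torsion: "\<And>x::'a. of_nat (Suc k) * x = 0 \<Longrightarrow> x = 0"
  shows "commutator (f * y * e) (\<phi> f) = 0"
proof -
  interpret swap: null_peirce_algebra scale f e by (rule swap)
  let ?y = "f * y * e"
  let ?w = "commutator ?y (\<phi> f)"
  have yf: "commutator ?y f = - ?y"
    by (simp add: commutator_def word_simps)
  have w: "?w = f * ?w * e"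
    using swap.M_right[of y "\<phi> f"] swap.M_left[of "\<phi> f" y] by (simp add: commutator_def word_simps)
  have adw: "ad j ?w = (- 1) ^ j * ?w" for j
    using ad_N[of j ?w] unfolding w[symmetric] .
  have my: "ad j (- ?y) = (- 1) ^ j * (- ?y)" for j
    using ad_N[of j "- y"] by simp
  have sgn: "commutator ((- 1) ^ j * - ?y) (\<phi> f) = - ((- 1) ^ j * ?w)" for j
    by (cases "even j") (simp_all add: commutator_def)
  \<comment> \<open>The exponents of the signs before and after the bracket with \<open>\<phi>(f)\<close> add up to \<open>k - 1\<close>,
    and \<open>[y, f] = -y\<close> contributes one more, so the sign does not depend on the position \<open>j\<close>.\<close>
  have summand: "ad (k - Suc j) (commutator (ad j (- ?y)) (\<phi> f)) = (- 1) ^ k * ?w" if "j < k" for j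
  proof -
    have "ad (k - Suc j) (- ((- 1) ^ j * ?w)) = (- 1) ^ (k - Suc j) * - ((- 1) ^ j * ?w)"
      using ad_N[of "k - Suc j" "- ((- 1) ^ j * ?w)"] w
      by (cases "even j") (simp_all)
    also have "\<dots> = (- 1) ^ (k - Suc j + Suc j) * ?w"
      by (simp only: power_add) (simp add: mult.assoc)
    also have "k - Suc j + Suc j = k" using that by simp
    finally show ?thesis by (simp only: my sgn)
  qed
  have "(\<Sum>j<k. ad (k - Suc j) (commutator (ad j (- ?y)) (\<phi> f))) = (\<Sum>j<k. (- 1) ^ k * ?w)"
    by (intro sum.cong refl summand) simp
  with lie_identity[of ?y f]
  have "\<phi> ((- 1) ^ k * - ?y) = ad (Suc k) (\<phi> ?y) + (- 1) ^ k * ?w + (\<Sum>j<k. (- 1) ^ k * ?w)"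
    unfolding yf my[of k] adw ad_shift by simp
  moreover have "\<phi> ((- 1) ^ k * - ?y) = (- 1) ^ k * - \<phi> ?y"
    by (cases "even k") simp_all
  moreover have "(\<Sum>j<k. (- 1) ^ k * ?w) = (- 1) ^ k * (of_nat k * ?w)"
    by (cases "even k") simp_all
  ultimately have "(- 1) ^ k * - \<phi> ?y = ad (Suc k) (\<phi> ?y) + (- 1) ^ k * (of_nat (Suc k) * ?w)"
    by (simp add: distrib_left distrib_right add.assoc)
  moreover have "f * ((- 1) ^ k * - \<phi> ?y) * e = f * ad (Suc k) (\<phi> ?y) * e"
    using ad_proj(2)[of "Suc k" "\<phi> ?y"] by (cases "even k") simp_all
  ultimately have "f * ((- 1) ^ k * (of_nat (Suc k) * ?w)) * e = 0"
    by (simp only: distrib_left distrib_right) simp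
  then have "f * (of_nat (Suc k) * ?w) * e = 0"
    by (cases "even k") simp_all
  then have "of_nat (Suc k) * ?w = 0"
    by (simp only: of_nat_inner w[symmetric])
  then show ?thesis by (rule torsion)
qed

lemma phi_f_diagonal_part_central:
  assumes torsion: "\<And>x::'a. of_nat (Suc k) * x = 0 \<Longrightarrow> x = 0"
  shows "e * \<phi> f * e + f * \<phi> f * f \<in> center"
proof (rule centralI)
  fix x
  have "e * commutator (e * x * f) (\<phi> f) * f = 0" "f * commutator (f * x * e) (\<phi> f) * e = 0"
    using phi_f_commutes_M[OF torsion, of x] phi_f_commutes_N[OF torsion, of x] by simp_all
  then show "e * (e * \<phi> f * e + f * \<phi> f * f) * e * x * f = e * x * f * (e * \<phi> f * e + f * \<phi> f * f) * f"
    "f * x * e * (e * \<phi> f * e + f * \<phi> f * f) * e = f * (e * \<phi> f * e + f * \<phi> f * f) * f * x * e"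
    by (simp_all add: commutator_def word_simps)
qed (simp_all add: word_simps)

end

text \<open>
  Subtracting an inner derivation reduces the general case to this one. The condition is symmetric:
  \<open>\<phi>(1)\<close> turns out to be central, hence so is \<open>\<phi>(e)\<close> (\<open>swap_normalised\<close>).
\<close>
locale normalised_lie_derivation = lie_derivation_null_peirce scale e f \<phi> k
  for scale :: "'r::comm_ring_1 \<Rightarrow> 'a::ring_1 \<Rightarrow> 'a" and e f :: 'a and \<phi> :: "'a \<Rightarrow> 'a" and k :: nat +
  assumes phi_f_central: "\<phi> f \<in> center"
begin

lemma lie_product_identity:
  "\<phi> (ad k (commutator u v)) = ad k (commutator (\<phi> u) v + commutator u (\<phi> v))"
proof -
  have "commutator x (\<phi> f) = 0" for x
    using center_commute[OF phi_f_central] by (simp add: commutator_def)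
  moreover have "ad j (x + y) = ad j x + ad j y" for j x y
    by (induction j) (simp_all add: commutator_def algebra_simps)
  ultimately show ?thesis
    by (simp add: lie_identity ad_zero)
qed

text \<open>Put \<open>v = f\<close>: corner elements commute with \<open>f\<close>, so the left-hand side is zero.\<close>
lemma phi_corner_diagonal:
  shows "e * \<phi> (e * x * e) * f = 0" "f * \<phi> (e * x * e) * e = 0"
proof -
  have "commutator (e * x * e) f = 0" "commutator (e * x * e) (\<phi> f) = 0"
    using center_commute[OF phi_f_central] by (simp_all add: commutator_def word_simps)
  then have "ad (Suc k) (\<phi> (e * x * e)) = 0"
    using lie_product_identity[of "e * x * e" f] by (simp add: ad_zero ad_shift del: funpow.simps(2))
  then show "e * \<phi> (e * x * e) * f = 0" "f * \<phi> (e * x * e) * e = 0"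
    using ad_proj[where j = "Suc k" and y = "\<phi> (e * x * e)"] by (cases "even k"; simp)+
qed

text \<open>
  Brackets with \<open>1\<close> vanish, so the identity with \<open>v = 1\<close> makes \<open>\<phi>(1)\<close> commute with the
  off-diagonal part.
\<close>
lemma phi_one_central: "\<phi> 1 \<in> center"
proof -
  have one: "\<phi> 1 = \<phi> (e * 1 * e) + \<phi> f"
    using phi_add[of e f] by (simp add: ee sum_one)
  have comm: "ad k (commutator u (\<phi> 1)) = 0" for u
    using lie_product_identity[of u 1] by (simp add: ad_zero)
  show ?thesis
  proof (rule centralI)
    show "e * \<phi> 1 * f = 0" "f * \<phi> 1 * e = 0"
      using phi_corner_diagonal[of 1] center_diag[OF phi_f_central] by (simp_all add: one algebra_simps)
    fix x
    have "e * commutator (e * x * f) (\<phi> 1) * f = 0"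
      using ad_proj(1)[of k "commutator (e * x * f) (\<phi> 1)"] by (simp add: comm)
    then show "e * \<phi> 1 * e * x * f = e * x * f * \<phi> 1 * f"
      by (simp add: commutator_def word_simps)
    have "f * commutator (f * x * e) (\<phi> 1) * e = 0"
      using ad_proj(2)[of k "commutator (f * x * e) (\<phi> 1)"] by (cases "even k") (simp_all add: comm)
    then show "f * x * e * \<phi> 1 * e = f * \<phi> 1 * f * x * e"
      by (simp add: commutator_def word_simps)
  qed
qed

lemma swap_normalised: "normalised_lie_derivation scale f e \<phi> k"
proof -
  interpret swap: null_peirce_algebra scale f e by (rule swap)
  have "\<phi> e = \<phi> 1 - \<phi> f"
    using phi_add[of e f] by (simp add: sum_one)
  then have "\<phi> e \<in> center"
    using center_linear(2)[OF phi_one_central phi_f_central] by simp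
  then show ?thesis
    by unfold_locales (auto intro: lie)
qed

lemma phi_M: "\<phi> (e * x * f) = e * \<phi> (e * x * f) * f - (- 1) ^ k * (f * \<phi> (e * x * f) * e)"
proof -
  have "commutator (e * x * f) f = e * x * f" "commutator (e * x * f) (\<phi> f) = 0"
    using center_commute[OF phi_f_central] by (simp_all add: commutator_def word_simps)
  then have "\<phi> (e * x * f) = ad (Suc k) (\<phi> (e * x * f))"
    using lie_product_identity[of "e * x * f" f] by (simp add: ad_M ad_shift del: funpow.simps(2))
  then show ?thesis by (rule trans[OF _ ad_Suc])
qed

text \<open>
  Comparing the \<open>N\<close>-components on both sides of the previous formula. The sign is trivial for odd \<open>k\<close>;
  for even \<open>k\<close> the relation reads \<open>w = -w\<close>. In both cases it serves to replace \<open>(-1)^k w\<close> by \<open>-w\<close>.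
\<close>
lemma phi_M_twist: "(- 1) ^ k * (f * \<phi> (e * x * f) * e) = - (f * \<phi> (e * x * f) * e)"
proof -
  have "f * \<phi> (e * x * f) * e = f * (e * \<phi> (e * x * f) * f - (- 1) ^ k * (f * \<phi> (e * x * f) * e)) * e"
    by (simp only: phi_M[symmetric])
  also have "\<dots> = - ((- 1) ^ k * (f * \<phi> (e * x * f) * e))"
    by (cases "even k") (simp_all add: word_simps)
  finally show ?thesis by (metis minus_minus)
qed

text \<open>
  The bracket of \<open>exe\<close> with an element of \<open>M\<close> is their product, and so is the bracket of an element of
  \<open>M\<close> with \<open>fyf\<close>. In the \<open>M\<close>-component the Leibniz rule for brackets gives a derivation up to
  the components \<open>f \<phi>(exe) f\<close> and \<open>e \<phi>(fyf) e\<close>; in the \<open>N\<close>-component only the reversed product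
  survives.
\<close>
lemma phi_corner_M:
  shows "e * \<phi> (e * x * e * y * f) * f
      = e * \<phi> (e * x * e) * e * y * f - e * y * f * \<phi> (e * x * e) * f + e * x * e * \<phi> (e * y * f) * f"
    and "f * \<phi> (e * x * e * y * f) * e = f * \<phi> (e * y * f) * e * x * e"
proof -
  let ?w = "commutator (\<phi> (e * x * e)) (e * y * f) + commutator (e * x * e) (\<phi> (e * y * f))"
  have "commutator (e * x * e) (e * y * f) = e * (x * e * y) * f"
    by (simp add: commutator_def word_simps)
  then have phi: "\<phi> (e * x * e * y * f) = ad k ?w"
    using lie_product_identity[of "e * x * e" "e * y * f"] ad_M[of k "x * e * y"]
    by (simp add: mult.assoc)
  show "e * \<phi> (e * x * e * y * f) * f
      = e * \<phi> (e * x * e) * e * y * f - e * y * f * \<phi> (e * x * e) * f + e * x * e * \<phi> (e * y * f) * f"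
    unfolding phi ad_proj by (simp add: commutator_def word_simps)
  have "f * ?w * e = - (f * \<phi> (e * y * f) * e) * x * e"
    by (simp add: commutator_def word_simps)
  then have "f * \<phi> (e * x * e * y * f) * e = - ((- 1) ^ k * (f * \<phi> (e * y * f) * e) * x * e)"
    unfolding phi ad_proj by (simp add: mult.assoc)
  then show "f * \<phi> (e * x * e * y * f) * e = f * \<phi> (e * y * f) * e * x * e"
    by (simp only: phi_M_twist) (simp add: mult.assoc)
qed

lemma phi_M_corner:
  shows "e * \<phi> (e * x * f * y * f) * f
      = e * \<phi> (e * x * f) * f * y * f + e * x * f * \<phi> (f * y * f) * f - e * \<phi> (f * y * f) * e * x * f"
    and "f * \<phi> (e * x * f * y * f) * e = f * y * f * \<phi> (e * x * f) * e"
proof -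
  let ?w = "commutator (\<phi> (e * x * f)) (f * y * f) + commutator (e * x * f) (\<phi> (f * y * f))"
  have "commutator (e * x * f) (f * y * f) = e * (x * f * y) * f"
    by (simp add: commutator_def word_simps)
  then have phi: "\<phi> (e * x * f * y * f) = ad k ?w"
    using lie_product_identity[of "e * x * f" "f * y * f"] ad_M[of k "x * f * y"]
    by (simp add: mult.assoc)
  show "e * \<phi> (e * x * f * y * f) * f
      = e * \<phi> (e * x * f) * f * y * f + e * x * f * \<phi> (f * y * f) * f - e * \<phi> (f * y * f) * e * x * f"
    unfolding phi ad_proj by (simp add: commutator_def word_simps)
  have "(- 1) ^ k * (f * ?w * e) = - (f * y * ((- 1) ^ k * (f * \<phi> (e * x * f) * e)))"
    by (cases "even k") (simp_all add: commutator_def word_simps)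
  then show "f * \<phi> (e * x * f * y * f) * e = f * y * f * \<phi> (e * x * f) * e"
    unfolding phi ad_proj by (simp only: phi_M_twist) (simp add: mult.assoc)
qed

text \<open>A central element with prescribed \<open>f\<close>-corner is unique, so the choice is automatically linear.\<close>
lemma central_lift:
  assumes lift: "\<And>x. \<exists>z\<in>center. f * \<phi> (e * x * e) * f = f * z * f"
  obtains \<gamma> where "linear_map scale \<gamma>" "\<And>x. \<gamma> x \<in> center"
    "\<And>x. f * \<gamma> x * f = f * \<phi> (e * x * e) * f"
proof -
  obtain \<gamma> where \<gamma>: "\<gamma> x \<in> center" "f * \<gamma> x * f = f * \<phi> (e * x * e) * f" for x
    using lift by metis
  have "linear_map scale \<gamma>"
    unfolding module_hom_iff
  proof (intro conjI allI)
    fix x y r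
    show "\<gamma> (x + y) = \<gamma> x + \<gamma> y"
      by (rule center_eqI) (simp_all add: \<gamma> center_linear phi_add distrib_left distrib_right)
    show "\<gamma> (scale r x) = scale r (\<gamma> x)"
      by (rule center_eqI) (simp_all add: \<gamma> center_linear scale_mult_left scale_mult_right
          module_hom.scale[OF linear])
  qed (rule module_axioms)+
  then show thesis using \<gamma> by (rule that)
qed

text \<open>
  Passing to a corner is multiplicative since \<open>MN = NM = 0\<close>. So the \<open>e\<close>-corner of the iterated
  commutator is the one of the \<open>e\<close>-corners \<open>a_i\<close> of its entries, and \<open>\<gamma>\<close> of it is governed by the
  \<open>f\<close>-corners of the terms of \<open>\<phi>(p_n(a_1, \<dots>, a_n))\<close>. These are iterated commutators of
  \<open>f\<close>-corners, and all entries but one have \<open>f\<close>-corner zero.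
\<close>
lemma central_lift_vanishes:
  assumes \<gamma>: "\<And>x. \<gamma> x \<in> center" "\<And>x. f * \<gamma> x * f = f * \<phi> (e * x * e) * f"
  shows "\<gamma> (lie_poly (Suc (Suc k)) x) = 0"
proof (rule center_zeroI)
  have corner: "p * lie_poly m x * p = lie_poly m (\<lambda>i. p * x i * p)"
    if "m \<ge> 1" "p \<in> {e, f}" for m p and x :: "nat \<Rightarrow> 'a"
    using that(1)
  proof (induction m x rule: lie_poly.induct)
    case (3 m x)
    have "p * commutator u v * p = commutator (p * u * p) (p * v * p)" for u v
    proof -
      have "p * (u * v) * p = p * u * p * (p * v * p)" for u v
      proof -
        have "p * (u * v) * p = p * u * e * v * p + p * u * f * v * p"
          by (subst left_split[of v]) (simp add: algebra_simps)
        then show ?thesis using that(2) by (auto simp: mult.assoc words)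
      qed
      then show ?thesis by (simp add: commutator_def right_diff_distrib left_diff_distrib)
    qed
    with 3 show ?case by simp
  qed auto
  let ?a = "\<lambda>i. e * x i * e"
  have "f * \<phi> (lie_poly (Suc (Suc k)) ?a) * f
      = (\<Sum>i=1..Suc (Suc k). f * lie_poly (Suc (Suc k)) (?a(i := \<phi> (?a i))) * f)"
    using lie by (simp add: lie_n_derivation_def sum_distrib_left sum_distrib_right del: sum.cl_ivl_Suc lie_poly.simps fun_upd_apply)
  also have "\<dots> = 0"
  proof (rule sum.neutral, rule ballI)
    fix i assume "i \<in> {1..Suc (Suc k)}"
    let ?Y = "\<lambda>j. f * (?a(i := \<phi> (?a i))) j * f"
    \<comment> \<open>As there are at least two entries, one of them is some unchanged \<open>e x_j e\<close>.\<close>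
    obtain j where "1 \<le> j" "j \<le> Suc (Suc k)" "j \<noteq> i"
      by (rule that[of "if i = 1 then 2 else 1"]) simp_all
    then have "lie_poly (Suc (Suc k)) ?Y = 0"
      by (intro lie_poly_zero_entry[of j]) (simp_all add: word_simps)
    then show "f * lie_poly (Suc (Suc k)) (?a(i := \<phi> (?a i))) * f = 0"
      by (subst corner) simp_all
  qed
  finally show "f * \<gamma> (lie_poly (Suc (Suc k)) x) * f = 0"
    using corner[of "Suc (Suc k)" e x] by (simp add: \<gamma> del: lie_poly.simps)
qed (rule \<gamma>)

theorem normalised_decomposition:
  assumes lift_f: "\<And>x. \<exists>z\<in>center. f * \<phi> (e * x * e) * f = f * z * f"
    and lift_e: "\<And>x. \<exists>z\<in>center. e * \<phi> (f * x * f) * e = e * z * e"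
  obtains d \<delta> \<gamma> where "\<And>x. \<phi> x = d x + \<delta> x + \<gamma> x"
    "derivation scale d" "singular_jordan_derivation scale e \<delta>" "antiderivation scale \<delta>"
    "linear_map scale \<gamma>" "range \<gamma> \<subseteq> center" "\<And>x. \<gamma> (lie_poly (Suc (Suc k)) x) = 0"
proof -
  interpret swap: normalised_lie_derivation scale f e \<phi> k by (rule swap_normalised)
  obtain \<alpha> where \<alpha>: "linear_map scale \<alpha>" "\<And>x. \<alpha> x \<in> center"
    "\<And>x. f * \<alpha> x * f = f * \<phi> (e * x * e) * f"
    by (rule central_lift[OF lift_f], rule that)
  obtain \<beta> where \<beta>: "linear_map scale \<beta>" "\<And>x. \<beta> x \<in> center"
    "\<And>x. e * \<beta> x * e = e * \<phi> (f * x * f) * e"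
    by (rule swap.central_lift[OF lift_e], rule that)
  \<comment> \<open>\<open>d\<close> is the part of \<open>\<phi>\<close> preserving each Peirce component, with the corners corrected by
    the central lifts; \<open>\<delta>\<close> is the part exchanging \<open>M\<close> and \<open>N\<close>.\<close>
  define d where "d x = e * (\<phi> (e * x * e) - \<alpha> x) * e + e * \<phi> (e * x * f) * f
      + f * \<phi> (f * x * e) * e + f * (\<phi> (f * x * f) - \<beta> x) * f" for x
  define \<delta> where "\<delta> x = f * \<phi> (e * x * f) * e + e * \<phi> (f * x * e) * f" for x
  define \<gamma> where "\<gamma> x = \<alpha> x + \<beta> x" for x
  note lin = phi_add module_hom.scale[OF linear] module_hom.add[OF \<alpha>(1)] module_hom.scale[OF \<alpha>(1)]
    module_hom.add[OF \<beta>(1)] module_hom.scale[OF \<beta>(1)]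
  note scale_simps = scale_mult_left scale_mult_right scale_right_distrib scale_right_diff_distrib
  have lin_d: "linear_map scale d" and lin_\<delta>: "linear_map scale \<delta>" and lin_\<gamma>: "linear_map scale \<gamma>"
    by (simp_all add: module_hom_iff module_axioms d_def \<delta>_def \<gamma>_def lin scale_simps algebra_simps)

  have sum: "\<phi> x = d x + \<delta> x + \<gamma> x" for x
  proof -
    have split: "\<phi> x = \<phi> (e * x * e) + \<phi> (e * x * f) + \<phi> (f * x * e) + \<phi> (f * x * f)"
      by (subst peirce) (simp only: phi_add)
    have corner_diff: "u = p * (u - v) * p + v" if "u = p * u * p + q" "v = p * v * p + q" for p q u v :: 'a
    proof -
      have "u - v = (p * u * p + q) - (p * v * p + q)"
        by (rule arg_cong2[where f = minus, OF that])
      also have "\<dots> = p * (u - v) * p" by (simp add: algebra_simps)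
      finally show ?thesis by (metis diff_add_cancel)
    qed
    have ee: "\<phi> (e * x * e) = e * (\<phi> (e * x * e) - \<alpha> x) * e + \<alpha> x"
    proof (rule corner_diff)
      show "\<phi> (e * x * e) = e * \<phi> (e * x * e) * e + f * \<phi> (e * x * e) * f"
        by (rule trans[OF peirce]) (simp add: phi_corner_diagonal)
      show "\<alpha> x = e * \<alpha> x * e + f * \<phi> (e * x * e) * f"
        by (rule trans[OF peirce]) (simp add: center_diag[OF \<alpha>(2)] \<alpha>(3))
    qed
    have ff: "\<phi> (f * x * f) = f * (\<phi> (f * x * f) - \<beta> x) * f + \<beta> x"
    proof (rule corner_diff)
      show "\<phi> (f * x * f) = f * \<phi> (f * x * f) * f + e * \<phi> (f * x * f) * e"
        by (rule trans[OF swap.peirce]) (simp add: swap.phi_corner_diagonal)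
      show "\<beta> x = f * \<beta> x * f + e * \<phi> (f * x * f) * e"
        by (rule trans[OF swap.peirce]) (simp add: swap.center_diag[OF \<beta>(2)] \<beta>(3))
    qed
    have ef: "\<phi> (e * x * f) = e * \<phi> (e * x * f) * f + f * \<phi> (e * x * f) * e"
      using phi_M[of x] by (simp add: phi_M_twist)
    have fe: "\<phi> (f * x * e) = f * \<phi> (f * x * e) * e + e * \<phi> (f * x * e) * f"
      using swap.phi_M[of x] by (simp add: swap.phi_M_twist)
    have "\<phi> x = (e * (\<phi> (e * x * e) - \<alpha> x) * e + \<alpha> x)
        + (e * \<phi> (e * x * f) * f + f * \<phi> (e * x * f) * e)
        + (f * \<phi> (f * x * e) * e + e * \<phi> (f * x * e) * f)
        + (f * (\<phi> (f * x * f) - \<beta> x) * f + \<beta> x)"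
      by (simp only: ee[symmetric] ff[symmetric] ef[symmetric] fe[symmetric] split[symmetric])
    then show ?thesis
      unfolding d_def \<delta>_def \<gamma>_def by (simp only: add_ac)
  qed

  have \<alpha>_corner: "\<alpha> (e * x * e) = \<alpha> x" for x
    by (rule center_eqI[OF \<alpha>(2) \<alpha>(2)]) (simp only: \<alpha>(3), simp add: mult.assoc words)
  have \<beta>_corner: "\<beta> (f * x * f) = \<beta> x" for x
    by (rule swap.center_eqI[OF \<beta>(2) \<beta>(2)]) (simp only: \<beta>(3), simp add: mult.assoc words)
  have \<alpha>_zero: "\<alpha> (e * x * f) = 0" "\<alpha> (f * x * e) = 0" "\<alpha> (f * x * f) = 0" for x
    by (rule center_zeroI[OF \<alpha>(2)], simp only: \<alpha>(3), simp add: mult.assoc words)+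
  have \<beta>_zero: "\<beta> (e * x * e) = 0" "\<beta> (e * x * f) = 0" "\<beta> (f * x * e) = 0" for x
    by (rule swap.center_zeroI[OF \<beta>(2)], simp only: \<beta>(3), simp add: mult.assoc words)+
  have d_ee: "d (e * x * e) = e * (\<phi> (e * x * e) - \<alpha> x) * e" for x
    using \<alpha>_corner[of x] \<beta>_zero(1)[of x] by (simp add: d_def mult.assoc words)
  have d_ff: "d (f * x * f) = f * (\<phi> (f * x * f) - \<beta> x) * f" for x
    using \<beta>_corner[of x] \<alpha>_zero(3)[of x] by (simp add: d_def mult.assoc words)
  have d_ef: "d (e * x * f) = e * \<phi> (e * x * f) * f" for x
    using \<alpha>_zero(1)[of x] \<beta>_zero(2)[of x] by (simp add: d_def mult.assoc words)
  have d_fe: "d (f * x * e) = f * \<phi> (f * x * e) * e" for x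
    using \<alpha>_zero(2)[of x] \<beta>_zero(3)[of x] by (simp add: d_def mult.assoc words)
  have comp: "d (p * x * q) = p * d (p * x * q) * q" if "p \<in> {e, f}" "q \<in> {e, f}" for p q x
    using that by (auto simp: d_ee d_ff d_ef d_fe) (simp_all add: mult.assoc words)

  have eef: "d (e * x * e * y * f) = d (e * x * e) * y * f + e * x * d (e * y * f)" for x y
  proof -
    have "e * y * f * \<phi> (e * x * e) * f = e * y * (f * \<alpha> x * f)"
      by (simp add: \<alpha>(3)) (simp add: mult.assoc words)
    also have "\<dots> = e * \<alpha> x * e * y * f"
      using center_intertwines[OF \<alpha>(2)] by (simp add: mult.assoc)
    finally have "e * \<phi> (e * x * e * y * f) * f
        = e * (\<phi> (e * x * e) - \<alpha> x) * e * y * f + e * x * e * \<phi> (e * y * f) * f"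
      by (simp only: phi_corner_M(1)) (simp add: algebra_simps)
    moreover have "d (e * x * e * y * f) = e * \<phi> (e * x * e * y * f) * f"
      using d_ef[of "x * e * y"] by (simp only: mult.assoc)
    ultimately show ?thesis
      unfolding d_ee d_ef by (simp add: mult.assoc words)
  qed
  have eff: "d (e * x * f * y * f) = d (e * x * f) * y * f + e * x * d (f * y * f)" for x y
  proof -
    have "e * \<phi> (f * y * f) * e * x * f = e * \<beta> y * e * x * f"
      by (simp add: \<beta>(3))
    also have "\<dots> = e * x * f * \<beta> y * f"
      by (rule center_intertwines[OF \<beta>(2)])
    finally have "e * \<phi> (e * x * f * y * f) * f
        = e * \<phi> (e * x * f) * f * y * f + e * x * f * (\<phi> (f * y * f) - \<beta> y) * f"
      by (simp only: phi_M_corner(1)) (simp add: algebra_simps)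
    moreover have "d (e * x * f * y * f) = e * \<phi> (e * x * f * y * f) * f"
      using d_ef[of "x * f * y"] by (simp only: mult.assoc)
    ultimately show ?thesis
      unfolding d_ff d_ef by (simp add: mult.assoc words)
  qed
  have ffe: "d (f * x * f * y * e) = d (f * x * f) * y * e + f * x * d (f * y * e)" for x y
  proof -
    have "f * y * e * \<phi> (f * x * f) * e = f * y * (e * \<beta> x * e)"
      by (simp add: \<beta>(3)) (simp add: mult.assoc words)
    also have "\<dots> = f * \<beta> x * f * y * e"
      using swap.center_intertwines[OF \<beta>(2)] by (simp add: mult.assoc)
    finally have "f * \<phi> (f * x * f * y * e) * e
        = f * (\<phi> (f * x * f) - \<beta> x) * f * y * e + f * x * f * \<phi> (f * y * e) * e"
      by (simp only: swap.phi_corner_M(1)) (simp add: algebra_simps)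
    moreover have "d (f * x * f * y * e) = f * \<phi> (f * x * f * y * e) * e"
      using d_fe[of "x * f * y"] by (simp only: mult.assoc)
    ultimately show ?thesis
      unfolding d_ff d_fe by (simp add: mult.assoc words)
  qed
  have fee: "d (f * x * e * y * e) = d (f * x * e) * y * e + f * x * d (e * y * e)" for x y
  proof -
    have "f * \<phi> (e * y * e) * f * x * e = f * \<alpha> y * f * x * e"
      by (simp add: \<alpha>(3))
    also have "\<dots> = f * x * e * \<alpha> y * e"
      by (rule swap.center_intertwines[OF \<alpha>(2)])
    finally have "f * \<phi> (f * x * e * y * e) * e
        = f * \<phi> (f * x * e) * e * y * e + f * x * e * (\<phi> (e * y * e) - \<alpha> y) * e"
      by (simp only: swap.phi_M_corner(1)) (simp add: algebra_simps)
    moreover have "d (f * x * e * y * e) = f * \<phi> (f * x * e * y * e) * e"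
      using d_fe[of "x * e * y"] by (simp only: mult.assoc)
    ultimately show ?thesis
      unfolding d_ee d_fe by (simp add: mult.assoc words)
  qed
  have d0: "d 0 = 0" by (rule module_hom.zero[OF lin_d])
  have mult: "d (p * x * q * y * r) = d (p * x * q) * y * r + p * x * d (q * y * r)"
    if "p \<in> {e, f}" "q \<in> {e, f}" "r \<in> {e, f}" for p q r x y
  proof -
    have "d (e * x * e * y * e) = d (e * x * e) * y * e + e * x * d (e * y * e)"
      by (rule derivation_corner[OF comp eef fee])
    moreover have "d (f * x * f * y * f) = d (f * x * f) * y * f + f * x * d (f * y * f)"
      by (rule swap.derivation_corner[OF comp ffe eff]) auto
    moreover have "d (e * x * f * y * e) = d (e * x * f) * y * e + e * x * d (f * y * e)"
      by (simp add: d_ef d_fe efe d0) (simp add: mult.assoc words)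
    moreover have "d (f * x * e * y * f) = d (f * x * e) * y * f + f * x * d (e * y * f)"
      by (simp add: d_ef d_fe fef d0) (simp add: mult.assoc words)
    ultimately show ?thesis
      using that eef[of x y] eff[of x y] fee[of x y] ffe[of x y] by auto
  qed
  have "derivation scale d"
    unfolding derivation_def
    using lin_d derivation_from_components[OF module_hom.add[OF lin_d] mult] by blast

  moreover
  have anti: "\<delta> (x * y) = \<delta> y * x + y * \<delta> x" for x y
  proof -
    have M: "e * (x * y) * f = e * x * e * y * f + e * x * f * y * f"
      and N: "f * (x * y) * e = f * x * e * y * e + f * x * f * y * e"
      by (subst left_split[of y], simp add: algebra_simps)+
    have "\<delta> (x * y) = f * \<phi> (e * y * f) * e * x * e + f * y * f * \<phi> (e * x * f) * e
        + (e * y * e * \<phi> (f * x * e) * f + e * \<phi> (f * y * e) * f * x * f)"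
      unfolding \<delta>_def M N phi_add distrib_left distrib_right
      by (simp only: phi_corner_M(2) phi_M_corner(2) swap.phi_corner_M(2) swap.phi_M_corner(2))
    moreover have "\<delta> y * x = f * \<phi> (e * y * f) * e * x * e + e * \<phi> (f * y * e) * f * x * f"
      using M_right[of "\<phi> (f * y * e)" x] swap.M_right[of "\<phi> (e * y * f)" x]
      by (simp only: \<delta>_def distrib_right)
    moreover have "y * \<delta> x = f * y * f * \<phi> (e * x * f) * e + e * y * e * \<phi> (f * x * e) * f"
      using M_left[of y "\<phi> (f * x * e)"] swap.M_left[of y "\<phi> (e * x * f)"]
      by (simp only: \<delta>_def distrib_left mult.assoc)
    ultimately show ?thesis by (simp only: add_ac)
  qed
  have "singular_jordan_derivation scale e \<delta>"
  proof -
    have "jordan_derivation scale \<delta>"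
      unfolding jordan_derivation_def jordan_product_def
      using lin_\<delta> by (simp add: module_hom.add[OF lin_\<delta>] anti algebra_simps)
    moreover have "\<delta> (e * x * e) = 0" "\<delta> (f * x * f) = 0"
      "\<delta> (e * x * f) = f * \<phi> (e * x * f) * e" "\<delta> (f * x * e) = e * \<phi> (f * x * e) * f" for x
      by (simp_all add: \<delta>_def mult.assoc words)
    moreover have "corner p UNIV q = range (\<lambda>s. p * s * q)" for p q :: 'a
      by (auto simp: corner_def)
    ultimately show ?thesis
      unfolding singular_jordan_derivation_def f_eq[symmetric] Let_def
      by (auto simp: image_image)
  qed

  moreover have "antiderivation scale \<delta>"
    unfolding antiderivation_def using lin_\<delta> anti by blast
  moreover note lin_\<gamma>
  moreover have "range \<gamma> \<subseteq> center"
    using \<alpha>(2) \<beta>(2) by (auto simp: \<gamma>_def center_linear)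
  moreover have "\<gamma> (lie_poly (Suc (Suc k)) x) = 0" for x
    using central_lift_vanishes[OF \<alpha>(2,3)] swap.central_lift_vanishes[OF \<beta>(2,3)]
    by (simp add: \<gamma>_def del: lie_poly.simps)
  ultimately show thesis
    by (rule that[OF sum])
qed

end

section \<open>The decomposition theorem\<close>

lemma null_peirce_algebraI:
  fixes scale :: "'r::comm_ring_1 \<Rightarrow> 'a::ring_1 \<Rightarrow> 'a"
  assumes "unital_algebra scale"
    and "nontrivial_idempotent e"
    and f: "f = 1 - e"
    and faithful_e: "\<And>x. {e * x * e} * corner e UNIV f = {0} \<Longrightarrow> corner f UNIV e * {e * x * e} = {0} \<Longrightarrow>
            e * x * e = 0"
    and faithful_f: "\<And>x. corner e UNIV f * {f * x * f} = {0} \<Longrightarrow> {f * x * f} * corner f UNIV e = {0} \<Longrightarrow>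
            f * x * f = 0"
    and MN: "corner e UNIV f * corner f UNIV e = {0}"
    and NM: "corner f UNIV e * corner e UNIV f = {0}"
  shows "null_peirce_algebra scale e f"
proof -
  interpret unital_algebra scale by fact
  have ee: "e * e = e"
    using assms(2) by (simp add: nontrivial_idempotent_def power2_eq_square)
  then have ff: "f * f = f" by (simp add: f algebra_simps)
  have idem: "e * (e * x) = e * x" "f * (f * x) = f * x" for x
    by (simp_all add: ee ff flip: mult.assoc)
  have left: "{a} * corner p UNIV q = {0}" if "\<And>y. a * (p * y * q) = 0" for a p q :: 'a
    using that by (auto simp: set_times_def corner_def)
  have right: "corner p UNIV q * {a} = {0}" if "\<And>y. p * y * q * a = 0" for a p q :: 'a
    using that by (auto simp: set_times_def corner_def)
  have null: "p * x * q * (r * y * s) = 0" if "corner p UNIV q * corner r UNIV s = {0}" for p q r s x y :: 'a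
    using set_times_intro[of "p * x * q" "corner p UNIV q" "r * y * s" "corner r UNIV s"] that
    by (auto simp: corner_def)
  show ?thesis
  proof
    show "e + f = 1" by (simp add: f)
    show "e * e = e" by (rule ee)
    show "e * x * f * y * e = 0" "f * x * e * y * f = 0" for x y
      using null[OF MN, of x y] null[OF NM, of x y] by (simp_all add: mult.assoc idem)
    show "e * x * e = 0" if "\<And>y. e * x * e * y * f = 0" "\<And>y. f * y * e * x * e = 0" for x
      using that by (intro faithful_e left right) (simp_all add: mult.assoc idem)
    show "f * x * f = 0" if "\<And>y. f * x * f * y * e = 0" "\<And>y. e * y * f * x * f = 0" for x
      using that by (intro faithful_f left right) (simp_all add: mult.assoc idem)
  qed
qed

lemma inner_derivation:
  assumes "unital_algebra scale"
  shows "derivation scale (\<lambda>x. commutator s x)"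
proof -
  interpret unital_algebra scale by fact
  show ?thesis
    by (simp add: derivation_def module_hom_iff module_axioms commutator_def scale_mult_left
        scale_mult_right scale_right_diff_distrib algebra_simps)
qed

lemma derivation_add:
  assumes "derivation scale d" "derivation scale d'"
  shows "derivation scale (\<lambda>x. d x + d' x)"
  using assms by (simp add: derivation_def module_hom_iff module.scale_right_distrib distrib_left distrib_right)

lemma lie_n_derivation_diff_derivation:
  assumes \<phi>: "lie_n_derivation scale n \<phi>" and d: "derivation scale d" and "n \<ge> 1"
  shows "lie_n_derivation scale n (\<lambda>x. \<phi> x - d x)"
  unfolding lie_n_derivation_def
proof (intro conjI allI)
  have "linear_map scale \<phi>" "linear_map scale d"
    using \<phi> d by (simp_all add: lie_n_derivation_def derivation_def)
  then show "linear_map scale (\<lambda>x. \<phi> x - d x)"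
    by (simp add: module_hom_iff module.scale_right_diff_distrib)
  fix x
  have "d (lie_poly n x) = (\<Sum>i=1..n. lie_poly n (x(i := d (x i))))"
    using d \<open>n \<ge> 1\<close> by (intro leibniz_lie_poly) (auto simp: derivation_def module_hom.add)
  then show "\<phi> (lie_poly n x) - d (lie_poly n x) = (\<Sum>i=1..n. lie_poly n (x(i := \<phi> (x i) - d (x i))))"
    using \<phi> by (simp add: lie_n_derivation_def lie_poly_diff sum_subtractf del: fun_upd_apply)
qed

theorem corollary2p9:
  fixes scale :: "'r::comm_ring_1 \<Rightarrow> 'a::ring_1 \<Rightarrow> 'a"
    and n :: nat and e f :: 'a and \<phi> :: "'a \<Rightarrow> 'a"
  assumes "n \<ge> 2"
    and "unital_algebra scale"
    and "nontrivial_idempotent e"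
    and "f = 1 - e"
    and "torsion_free 2 TYPE('a)"
    and "torsion_free (n - 1) TYPE('a)"
    and "\<And>x. {e * x * e} * corner e UNIV f = {0} \<Longrightarrow> corner f UNIV e * {e * x * e} = {0} \<Longrightarrow>
            e * x * e = 0"
    and "\<And>x. corner e UNIV f * {f * x * f} = {0} \<Longrightarrow> {f * x * f} * corner f UNIV e = {0} \<Longrightarrow>
            f * x * f = 0"
    and "corner e UNIV f * corner f UNIV e = {0}"
    and "corner f UNIV e * corner e UNIV f = {0}"
    and "lie_n_derivation scale n \<phi>"
  shows "(\<exists>d \<delta> \<gamma>. (\<forall>x. \<phi> x = d x + \<delta> x + \<gamma> x) \<and>
            derivation scale d \<and>
            singular_jordan_derivation scale e \<delta> \<and> antiderivation scale \<delta> \<and>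
            linear_map scale \<gamma> \<and> range \<gamma> \<subseteq> center \<and> (\<forall>x. \<gamma> (lie_poly n x) = 0))
         \<longleftrightarrow> corner f (\<phi> ` corner e UNIV e) f \<subseteq> corner f center f \<and>
             corner e (\<phi> ` corner f UNIV f) e \<subseteq> corner e center e"
proof -
  interpret null_peirce_algebra scale e f
    by (rule null_peirce_algebraI[OF assms(2-4) assms(7-10)])
  obtain k where n: "n = Suc (Suc k)"
    using \<open>n \<ge> 2\<close> by (metis add_2_eq_Suc le_Suc_ex)
  interpret lie_derivation_null_peirce scale e f \<phi> k
    using assms(11) unfolding n by unfold_locales
  have torsion: "x = 0" if "of_nat (Suc k) * x = 0" for x :: 'a
    using assms(6) that unfolding torsion_free_def n diff_Suc_1 by blast
  show ?thesis (is "?decomposable \<longleftrightarrow> ?corners")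
  proof
    assume ?decomposable
    then obtain d \<delta> \<gamma> where dec: "\<And>x. \<phi> x = d x + \<delta> x + \<gamma> x"
      and d: "\<And>x y. d (x * y) = d x * y + x * d y"
      and \<delta>: "\<delta> ` corner e UNIV e = {0}" "\<delta> ` corner f UNIV f = {0}"
      and \<gamma>: "range \<gamma> \<subseteq> center"
      by (auto simp: derivation_def singular_jordan_derivation_def Let_def f_eq)
    have "\<delta> (e * x * e) = 0" "\<delta> (f * x * f) = 0" for x
      using \<delta> by (auto simp: corner_def)
    moreover have "f * d (e * x * e) * f = 0" "e * d (f * x * f) * e = 0" for x
      using d[of e "x * e"] d[of f "x * f"] by (simp_all add: word_simps)
    ultimately have "f * \<phi> (e * x * e) * f = f * \<gamma> (e * x * e) * f"
      "e * \<phi> (f * x * f) * e = e * \<gamma> (f * x * f) * e" for x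
      by (simp_all add: dec distrib_left distrib_right)
    moreover have "\<gamma> x \<in> center" for x
      using \<gamma> by blast
    ultimately show ?corners
      unfolding corner_def by fastforce
  next
    assume corners: ?corners
    \<comment> \<open>The signs make \<open>[s, f]\<close> the off-diagonal part of \<open>\<phi>(f)\<close>.\<close>
    define s where "s = e * \<phi> f * f - f * \<phi> f * e"
    define \<psi> where "\<psi> x = \<phi> x - commutator s x" for x
    note inner = inner_derivation[OF assms(2), of s]
    have "commutator s f = e * \<phi> f * f + f * \<phi> f * e"
      by (simp add: s_def commutator_def word_simps)
    then have "\<psi> f = e * \<phi> f * e + f * \<phi> f * f"
      unfolding \<psi>_def by (subst peirce) (simp add: algebra_simps)
    then have \<psi>_f: "\<psi> f \<in> center"
      by (simp only: phi_f_diagonal_part_central[OF torsion])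
    have \<psi>_lie: "lie_n_derivation scale (Suc (Suc k)) \<psi>"
      unfolding \<psi>_def by (intro lie_n_derivation_diff_derivation lie inner) simp
    interpret \<psi>: normalised_lie_derivation scale e f \<psi> k
      by unfold_locales (auto intro: \<psi>_f \<psi>_lie)
    have "f * \<psi> (e * x * e) * f = f * \<phi> (e * x * e) * f"
      "e * \<psi> (f * x * f) * e = e * \<phi> (f * x * f) * e" for x
      by (simp_all add: \<psi>_def commutator_def word_simps)
    moreover have "f * \<phi> (e * x * e) * f \<in> corner f (\<phi> ` corner e UNIV e) f"
      "e * \<phi> (f * x * f) * e \<in> corner e (\<phi> ` corner f UNIV f) e" for x
      unfolding corner_def by blast+
    then have "f * \<phi> (e * x * e) * f \<in> corner f center f"
      "e * \<phi> (f * x * f) * e \<in> corner e center e" for x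
      using corners by blast+
    ultimately have lift: "\<exists>z\<in>center. f * \<psi> (e * x * e) * f = f * z * f"
      "\<exists>z\<in>center. e * \<psi> (f * x * f) * e = e * z * e" for x
      unfolding corner_def by force+
    obtain d \<delta> \<gamma> where dec: "\<And>x. \<psi> x = d x + \<delta> x + \<gamma> x"
      "derivation scale d" "singular_jordan_derivation scale e \<delta>" "antiderivation scale \<delta>"
      "linear_map scale \<gamma>" "range \<gamma> \<subseteq> center" "\<And>x. \<gamma> (lie_poly (Suc (Suc k)) x) = 0"
      by (rule \<psi>.normalised_decomposition[OF lift], rule that)
    show ?decomposable
      unfolding n
    proof (rule exI[of _ "\<lambda>x. d x + commutator s x"], rule exI[of _ \<delta>], rule exI[of _ \<gamma>],
        intro conjI allI)
      show "derivation scale (\<lambda>x. d x + commutator s x)"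
        by (rule derivation_add[OF dec(2) inner])
      show "\<phi> x = (d x + commutator s x) + \<delta> x + \<gamma> x" for x
        using dec(1)[of x] unfolding \<psi>_def by (simp only: diff_eq_eq add_ac)
    qed (rule dec)+
  qed
qed

end
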